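(* Let $n,k\ge1$ be integers. For every real number $q>0$, the Euler--Mahonian polynomial $$G_{n,k}^{\mathrm{fmaj}}(x,q)=\sum_{\pi^\xi\in\mathbb{Z}_k\wr\mathfrak{S}_n}x^{\operatorname{des}\pi^\xi}q^{\operatorname{fmaj}\pi^\xi},$$ viewed as a polynomial in $x$, has all real roots.
   Context: $\mathbb{Z}_k\wr\mathfrak{S}_n$ is regarded as the set of $k$-colored permutations, i.e. pairs $\pi^\xi=(\pi,\xi)$ with $\pi=(\pi_1,\dots,\pi_n)$ a permutation of $\{1,\dots,n\}$ and $\xi=(\xi_1,\dots,\xi_n)\in\{0,1,\dots,k-1\}^n$. With the convention $\pi_0=\xi_0=0$, the descent set is $\operatorname{Des}\pi^\xi=\{i\in\{0,\dots,n-1\}\mid \xi_i<\xi_{i+1},\text{ or }\xi_i=\xi_{i+1}\text{ and }\pi_i>\pi_{i+1}\}$, and $\operatorname{des}\pi^\xi=|\operatorname{Des}\pi^\xi|$, $\operatorname{comaj}\pi^\xi=\sum_{j\in\operatorname{Des}\pi^\xi}(n-j)$. The flag major index is $\operatorname{fmaj}\pi^\xi=k\operatorname{comaj}\pi^\xi-\sum_{i=1}^n\xi_i$. *)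

theory Defs
  imports
    "HOL-Combinatorics.Permutations"
    "HOL-Computational_Algebra.Polynomial"
    Complex_Main
begin

text \<open>
  A colored permutation is a pair \<open>(p, c)\<close> of a permutation of \<open>{1..n}\<close> and a color vector
  indexed by \<open>{1..n}\<close>, both encoded as functions on \<open>nat\<close>. Outside \<open>{1..n}\<close> the function \<open>p\<close>
  is the identity and \<open>c\<close> is zero, so that each colored permutation has exactly one encoding
  and the convention \<open>p 0 = c 0 = 0\<close> holds automatically.
\<close>

definition colored_perms :: "nat \<Rightarrow> nat \<Rightarrow> ((nat \<Rightarrow> nat) \<times> (nat \<Rightarrow> nat)) set" where
  "colored_perms k n =
     {(p, c). p permutes {1..n} \<and> (\<forall>i\<in>{1..n}. c i < k) \<and> (\<forall>i. i \<notin> {1..n} \<longrightarrow> c i = 0)}"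

definition Des :: "nat \<Rightarrow> (nat \<Rightarrow> nat) \<Rightarrow> (nat \<Rightarrow> nat) \<Rightarrow> nat set" where
  "Des n p c = {i\<in>{0..<n}. c i < c (i + 1) \<or> (c i = c (i + 1) \<and> p i > p (i + 1))}"

definition des :: "nat \<Rightarrow> (nat \<Rightarrow> nat) \<Rightarrow> (nat \<Rightarrow> nat) \<Rightarrow> nat" where
  "des n p c = card (Des n p c)"

definition comaj :: "nat \<Rightarrow> (nat \<Rightarrow> nat) \<Rightarrow> (nat \<Rightarrow> nat) \<Rightarrow> nat" where
  "comaj n p c = (\<Sum>j\<in>Des n p c. n - j)"

text \<open>The flag major index is integer-valued here to avoid truncated subtraction.\<close>

definition fmaj :: "nat \<Rightarrow> nat \<Rightarrow> (nat \<Rightarrow> nat) \<Rightarrow> (nat \<Rightarrow> nat) \<Rightarrow> int" where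
  "fmaj k n p c = int k * int (comaj n p c) - (\<Sum>i\<in>{1..n}. int (c i))"

definition euler_mahonian_poly :: "nat \<Rightarrow> nat \<Rightarrow> real \<Rightarrow> real poly" where
  "euler_mahonian_poly n k q =
     (\<Sum>(p, c)\<in>colored_perms k n. monom (q powi fmaj k n p c) (des n p c))"

text \<open>All complex roots are real; in particular, the zero polynomial is excluded.\<close>

definition real_rooted :: "real poly \<Rightarrow> bool" where
  "real_rooted f \<longleftrightarrow> (\<forall>z::complex. poly (map_poly complex_of_real f) z = 0 \<longrightarrow> z \<in> \<real>)"

end

theory Submission
  imports Defs
begin

text \<open>
  Write \<open>Q = q ^ k\<close> and \<open>G\<^sub>n\<close> for the polynomial. Inserting the letter \<open>n\<close>, with all colors
  and in all positions, into the colored permutations of size \<open>n - 1\<close> gives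
  \<open>(1 - q) G\<^sub>n(x) = (1 - x Q ^ n) G\<^sub>n\<^sub>-\<^sub>1(x) - q (1 - x) G\<^sub>n\<^sub>-\<^sub>1(Q x)\<close>.
  Let \<open>0 < q < 1\<close>. If the roots \<open>- r\<^sub>i\<close> of \<open>G\<^sub>n\<^sub>-\<^sub>1\<close> are negative and consecutive ratios exceed
  \<open>1 / Q\<close>, then the signs of the right-hand side at \<open>- r\<^sub>i\<close> and \<open>- r\<^sub>i / Q\<close> place one root of
  \<open>G\<^sub>n\<close> in each interval between \<open>- r\<^sub>i\<^sub>+\<^sub>1\<close> and \<open>- r\<^sub>i / Q\<close>, and these roots are again separated
  by the factor \<open>1 / Q\<close>. The case \<open>q > 1\<close> reduces to this one by the symmetry
  \<open>G\<^sub>n(x, 1 / q) = G\<^sub>n(x / Q ^ n, q)\<close>, and \<open>q = 1\<close> is a limit, since the degree of \<open>G\<^sub>n\<close>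
  does not depend on \<open>q\<close>.
\<close>

section \<open>Colored permutations as words\<close>

text \<open>A letter is a pair (value, color). Descents are ordinary descents for this strict total
  order, in which a larger color makes a letter smaller.\<close>

definition letter_gt :: "nat \<times> nat \<Rightarrow> nat \<times> nat \<Rightarrow> bool" where
  "letter_gt a b \<longleftrightarrow> snd a < snd b \<or> (snd a = snd b \<and> fst a > fst b)"

lemma letter_gt_asym: "letter_gt a b \<Longrightarrow> \<not> letter_gt b a"
  by (auto simp: letter_gt_def)

lemma letter_gt_total: "a \<noteq> b \<Longrightarrow> letter_gt a b \<or> letter_gt b a"
  by (cases a, cases b) (auto simp: letter_gt_def)

lemma letter_gt_trans: "letter_gt a b \<Longrightarrow> letter_gt b c \<Longrightarrow> letter_gt a c"
  by (auto simp: letter_gt_def)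

text \<open>The argument \<open>a\<close> is the letter standing just before the word. A descent
  into \<open>b # w\<close> costs \<open>X\<close> times \<open>Y\<close> to the number of letters
  from \<open>b\<close> on, which is the summand n - j of \<open>comaj\<close>; counting from the
  right makes the weight recursive on lists.\<close>

fun wt :: "real \<Rightarrow> real \<Rightarrow> nat \<times> nat \<Rightarrow> (nat \<times> nat) list \<Rightarrow> real" where
  "wt X Y a [] = 1"
| "wt X Y a (b # w) = (if letter_gt a b then X * Y ^ Suc (length w) else 1) * wt X Y b w"

definition insert_at :: "nat \<Rightarrow> 'a \<Rightarrow> 'a list \<Rightarrow> 'a list" where
  "insert_at i a w = take i w @ a # drop i w"

lemma insert_at_simps [simp]:
  "insert_at 0 a w = a # w"
  "insert_at (Suc i) a (b # w) = b # insert_at i a w"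
  "length (insert_at i a w) = Suc (length w)"
  by (simp_all add: insert_at_def)

text \<open>
  Replacing \<open>X\<close> by \<open>X * Y\<close> multiplies \<open>wt\<close> by \<open>Y\<close> to the number of descents, so the formula
  needs no explicit descent number; clearing \<open>1 - Y\<close> avoids geometric sums.
\<close>

lemma sum_wt_insert_at:
  assumes "a \<notin> set w" "a \<noteq> b"
  shows "(1 - Y) * (\<Sum>i\<le>length w. wt X Y b (insert_at i a w)) =
    (if letter_gt b a then Y else 1) * (1 - X * Y ^ Suc (length w)) * wt X Y b w
      - Y * (1 - X) * wt (X * Y) Y b w"
  using assms
proof (induction w arbitrary: b)
  case Nil
  then show ?case by (auto simp: insert_at_def algebra_simps)
next
  case (Cons c w)
  define m where "m = length w"
  define S where "S = (\<Sum>i\<le>m. wt X Y c (insert_at i a w))"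
  define U where "U = wt X Y c w"
  define V where "V = wt (X * Y) Y c w"
  have IH: "(1 - Y) * S = (if letter_gt c a then Y else 1) * (1 - X * Y ^ Suc m) * U
      - Y * (1 - X) * V"
    using Cons.IH[of c] Cons.prems by (auto simp: S_def U_def V_def m_def)
  \<comment> \<open>Position 0 puts \<open>a\<close> before \<open>c\<close>. Every other position
    keeps the step from \<open>b\<close> to \<open>c\<close>, but with one more letter to its right,
    hence the exponent \<open>Suc (Suc m)\<close>.\<close>
  have split: "(\<Sum>i\<le>length (c # w). wt X Y b (insert_at i a (c # w))) =
      wt X Y b (a # c # w) + (if letter_gt b c then X * Y ^ Suc (Suc m) else 1) * S"
    unfolding S_def sum_distrib_left
    by (simp add: m_def sum.atMost_Suc_shift del: sum.atMost_Suc)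
  have total: "letter_gt a c \<longleftrightarrow> \<not> letter_gt c a" "letter_gt b a \<longleftrightarrow> \<not> letter_gt a b"
    and trans: "letter_gt b a \<Longrightarrow> letter_gt a c \<Longrightarrow> letter_gt b c"
      "letter_gt c a \<Longrightarrow> letter_gt a b \<Longrightarrow> \<not> letter_gt b c"
    using Cons.prems letter_gt_total[of a c] letter_gt_total[of a b]
      letter_gt_trans[of b a c] letter_gt_trans[of c a b]
      letter_gt_asym[of a c] letter_gt_asym[of a b] letter_gt_asym[of b c]
    by (simp_all only: list.set insert_iff) blast+
  have "(1 - Y) * (\<Sum>i\<le>length (c # w). wt X Y b (insert_at i a (c # w))) =
      (1 - Y) * wt X Y b (a # c # w)
        + (if letter_gt b c then X * Y ^ Suc (Suc m) else 1) * ((1 - Y) * S)"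
    unfolding split by (simp only: distrib_left mult.left_commute)
  also have "\<dots> = (if letter_gt b a then Y else 1) * (1 - X * Y ^ Suc (length (c # w)))
        * wt X Y b (c # w) - Y * (1 - X) * wt (X * Y) Y b (c # w)"
  proof -
    define Z where "Z = Y ^ m"
    have wt_simps: "wt X Y b (a # c # w) = (if letter_gt b a then X * (Y * (Y * Z)) else 1)
          * ((if letter_gt c a then 1 else X * (Y * Z)) * U)"
        "wt X Y b (c # w) = (if letter_gt b c then X * (Y * Z) else 1) * U"
        "wt (X * Y) Y b (c # w) = (if letter_gt b c then X * Y * (Y * Z) else 1) * V"
        "Y ^ Suc m = Y * Z" "Y ^ Suc (Suc m) = Y * (Y * Z)"
        "Y ^ Suc (length (c # w)) = Y * (Y * Z)"
      by (simp_all add: total(1) U_def V_def Z_def flip: m_def)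
    show ?thesis
      unfolding IH wt_simps
      \<comment> \<open>Of the eight orderings of \<open>a\<close>, \<open>b\<close>,
        \<open>c\<close>, transitivity rules out two; the others are polynomial identities in
        \<open>X\<close>, \<open>Y\<close>, \<open>Z\<close>, \<open>U\<close>,
        \<open>V\<close>.\<close>
      by (cases "letter_gt c a"; cases "letter_gt b a"; cases "letter_gt b c")
        (use trans total in \<open>simp_all only: if_True if_False simp_thms, simp_all add: algebra_simps\<close>)
  qed
  finally show ?case .
qed

section \<open>Inserting the largest value into a word\<close>

definition words :: "nat \<Rightarrow> nat \<Rightarrow> (nat \<times> nat) list set" where
  "words k n =
     {w. distinct (map fst w) \<and> set (map fst w) = {1..n} \<and> (\<forall>l\<in>set w. snd l < k)}"

lemma length_words: "w \<in> words k n \<Longrightarrow> length w = n"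
  unfolding words_def using distinct_card[of "map fst w"] by force

lemma words_0 [simp]: "words k 0 = {[]}"
  by (auto simp: words_def)

text \<open>The value \<open>N\<close> occurs only in the inserted letter, so
  \<open>takeWhile\<close> and \<open>dropWhile\<close> recover the two halves of the word and the
  letter between them.\<close>

lemma insert_at_inj:
  assumes "insert_at i a w = insert_at j b v" "i \<le> length w" "j \<le> length v"
    and "\<forall>l\<in>set w. fst l \<noteq> N" "\<forall>l\<in>set v. fst l \<noteq> N" "fst a = N" "fst b = N"
  shows "i = j \<and> a = b \<and> w = v"
proof -
  have tk: "takeWhile (\<lambda>l. fst l \<noteq> N) (insert_at i a w) = take i w"
    and dr: "dropWhile (\<lambda>l. fst l \<noteq> N) (insert_at i a w) = a # drop i w"
    if "\<forall>l\<in>set w. fst l \<noteq> N" "fst a = N" for i and a :: "'a \<times> 'b" and w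
    using that by (auto simp: insert_at_def takeWhile_append dropWhile_append dest: in_set_takeD)
  have "take i w = take j v" "a # drop i w = b # drop j v"
    using tk dr assms by metis+
  then show ?thesis
    using assms(2,3) by (metis append_take_drop_id length_take list.inject min.absorb2)
qed

lemma bij_betw_insert_at_words:
  "bij_betw (\<lambda>(w, c, i). insert_at i (Suc n, c) w) (words k n \<times> {..<k} \<times> {..n})
     (words k (Suc n))"
  unfolding bij_betw_def
proof
  have fresh: "\<forall>l\<in>set w. fst l \<noteq> Suc n" if "w \<in> words k n" for w
    using that by (force simp: words_def)
  have "i = j \<and> (Suc n, c) = (Suc n, d) \<and> w = v"
    if "insert_at i (Suc n, c) w = insert_at j (Suc n, d) v" "w \<in> words k n" "v \<in> words k n"
      "i \<le> n" "j \<le> n" for i j c d w v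
    using that by (intro insert_at_inj[where N = "Suc n"] fresh) (simp_all add: length_words)
  then show "inj_on (\<lambda>(w, c, i). insert_at i (Suc n, c) w) (words k n \<times> {..<k} \<times> {..n})"
    by (intro inj_onI; clarify) (metis atMost_iff prod.inject)
  show "(\<lambda>(w, c, i). insert_at i (Suc n, c) w) ` (words k n \<times> {..<k} \<times> {..n})
      = words k (Suc n)" (is "?f ` ?A = _")
  proof (intro equalityI subsetI)
    fix v assume "v \<in> ?f ` ?A"
    then obtain w c i where v: "v = insert_at i (Suc n, c) w"
      and w: "w \<in> words k n" and c: "c < k" by auto
    \<comment> \<open>Insertion only rearranges the letters of \<open>(Suc n, c) # w\<close>, so
      distinctness and the letter set can be read off from multisets.\<close>
    have s: "mset v = mset ((Suc n, c) # w)"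
      by (simp add: v insert_at_def) (metis append_take_drop_id mset_append)
    then have "mset (map fst v) = mset (map fst ((Suc n, c) # w))"
      by (metis mset_map)
    moreover have "distinct (map fst ((Suc n, c) # w))"
      using w fresh[OF w] by (auto simp: words_def)
    ultimately have "distinct (map fst v)" "set (map fst v) = insert (Suc n) (set (map fst w))"
      by (metis mset_eq_imp_distinct_iff, metis list.simps(9) fst_conv list.simps(15) mset_eq_setD)
    moreover have "set v = insert (Suc n, c) (set w)"
      using s by (metis list.simps(15) mset_eq_setD)
    ultimately show "v \<in> words k (Suc n)"
      using w c unfolding words_def by auto
  next
    fix v assume v: "v \<in> words k (Suc n)"
    then have "Suc n \<in> set (map fst v)" by (simp add: words_def)
    then obtain c where "(Suc n, c) \<in> set v" by auto
    then obtain ys zs where yz: "v = ys @ (Suc n, c) # zs"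
      by (meson split_list)
    have fr: "Suc n \<notin> set (map fst (ys @ zs))" using v by (auto simp: words_def yz)
    have "set (map fst v) = insert (Suc n) (set (map fst (ys @ zs)))" by (auto simp: yz)
    then have "set (map fst (ys @ zs)) = {1..Suc n} - {Suc n}"
      using v Diff_insert_absorb[OF fr] by (simp add: words_def)
    then have "set (map fst (ys @ zs)) = {1..n}"
      by auto
    then have "ys @ zs \<in> words k n"
      using v by (auto simp: words_def yz)
    moreover have "c < k" using v by (auto simp: words_def yz)
    moreover have "length ys \<le> n" using length_words[OF v] by (simp add: yz)
    moreover have "v = insert_at (length ys) (Suc n, c) (ys @ zs)"
      by (simp add: yz insert_at_def)
    ultimately show "v \<in> ?f ` ?A"
      by (intro image_eqI[of _ _ "(ys @ zs, c, length ys)"]) auto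
  qed
qed

section \<open>From colored permutations to words, and from statistics to weights\<close>

definition word_of :: "nat \<Rightarrow> (nat \<Rightarrow> nat) \<times> (nat \<Rightarrow> nat) \<Rightarrow> (nat \<times> nat) list" where
  "word_of n = (\<lambda>(p, c). map (\<lambda>i. (p i, c i)) [Suc 0..<Suc n])"

lemma bij_betw_word_of: "bij_betw (word_of n) (colored_perms k n) (words k n)"
  unfolding bij_betw_def
proof
  show "inj_on (word_of n) (colored_perms k n)"
  proof (rule inj_onI, clarify)
    fix p c p' c'
    assume 1: "(p, c) \<in> colored_perms k n" "(p', c') \<in> colored_perms k n"
      and "word_of n (p, c) = word_of n (p', c')"
    then have "\<forall>i\<in>{1..n}. p i = p' i \<and> c i = c' i"
      by (auto simp: word_of_def simp del: upt_Suc)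
    moreover have "p i = p' i \<and> c i = c' i" if "i \<notin> {1..n}" for i
      using 1 that by (simp add: colored_perms_def permutes_def)
    ultimately show "p = p' \<and> c = c'" by (metis ext)
  qed
  show "word_of n ` colored_perms k n = words k n"
  proof (intro equalityI subsetI)
    fix v assume "v \<in> word_of n ` colored_perms k n"
    then obtain p c where v: "v = word_of n (p, c)" and pc: "(p, c) \<in> colored_perms k n" by auto
    have p: "p permutes {1..n}" using pc by (simp add: colored_perms_def)
    have m: "map fst v = map p [Suc 0..<Suc n]" by (simp add: v word_of_def del: upt_Suc)
    have "set (map fst v) = p ` {1..n}"
      unfolding m by (simp only: set_map set_upt atLeastLessThanSuc_atLeastAtMost One_nat_def)
    then have "set (map fst v) = {1..n}" using permutes_image[OF p] by simp
    moreover have "distinct (map fst v)"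
      unfolding m by (simp add: distinct_map permutes_inj_on[OF p] del: upt_Suc)
    moreover have "\<forall>l\<in>set v. snd l < k"
      using pc by (auto simp: v word_of_def colored_perms_def simp del: upt_Suc)
    ultimately show "v \<in> words k n" by (simp add: words_def)
  next
    fix v assume v: "v \<in> words k n"
    note len = length_words[OF v]
    \<comment> \<open>The values outside \<open>{1..n}\<close> are the ones fixed by the encoding in
      \<open>colored_perms\<close>; the shift by 1 is due to lists being indexed from 0.\<close>
    define p where "p = (\<lambda>i. if i \<in> {1..n} then fst (v ! (i - 1)) else i)"
    define c where "c = (\<lambda>i. if i \<in> {1..n} then snd (v ! (i - 1)) else 0)"
    have "bij_betw (\<lambda>i. i - 1) {1..n} {..<n}"
      by (rule bij_betw_byWitness[of _ Suc]) auto
    moreover have "bij_betw ((!) (map fst v)) {..<n} {1..n}"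
      by (rule bij_betw_nth) (use v len in \<open>auto simp: words_def\<close>)
    ultimately have "bij_betw ((!) (map fst v) \<circ> (\<lambda>i. i - 1)) {1..n} {1..n}"
      by (rule bij_betw_trans)
    then have "bij_betw p {1..n} {1..n}"
      by (rule bij_betw_cong[THEN iffD1, rotated]) (auto simp: p_def len)
    then have "p permutes {1..n}"
      by (rule bij_imp_permutes) (auto simp: p_def)
    moreover have "c i < k" if "i \<in> {1..n}" for i
    proof -
      have "v ! (i - 1) \<in> set v" using that len by (intro nth_mem) auto
      then show ?thesis using v that by (auto simp: c_def words_def)
    qed
    ultimately have "(p, c) \<in> colored_perms k n"
      by (auto simp: colored_perms_def c_def)
    moreover have "v = word_of n (p, c)"
      by (rule nth_equalityI)
        (auto simp: word_of_def p_def c_def len simp del: upt_Suc)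
    ultimately show "v \<in> word_of n ` colored_perms k n" by blast
  qed
qed

lemma wt_map_upt:
  assumes "m \<le> n"
  shows "wt X Y (z m) (map z [Suc m..<Suc n]) =
    (\<Prod>j\<in>{m..<n}. if letter_gt (z j) (z (Suc j)) then X * Y ^ (n - j) else 1)"
  using assms
proof (induction rule: inc_induct)
  case base
  then show ?case by simp
next
  case (step m)
  have "[Suc m..<Suc n] = Suc m # [Suc (Suc m)..<Suc n]"
    using step.hyps by (simp add: upt_rec)
  moreover have "Suc (length [Suc (Suc m)..<Suc n]) = n - m"
    using step.hyps by (simp del: upt_Suc)
  moreover have "{m..<n} = insert m {Suc m..<n}" using step.hyps by auto
  ultimately show ?case using step.IH by (simp del: upt_Suc)
qed

lemma wt_word_of:
  assumes "(p, c) \<in> colored_perms k n"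
  shows "wt X Y (0, 0) (word_of n (p, c)) = X ^ des n p c * Y ^ comaj n p c"
proof -
  \<comment> \<open>The start letter \<open>(0, 0)\<close> of \<open>wt\<close> realizes the
    convention at position 0, so a descent there is counted as well.\<close>
  have 0: "(p 0, c 0) = (0, 0)"
    using assms by (simp add: colored_perms_def permutes_def)
  have D: "Des n p c = {j\<in>{0..<n}. letter_gt (p j, c j) (p (Suc j), c (Suc j))}"
    by (simp add: Des_def letter_gt_def)
  show ?thesis
    using wt_map_upt[of 0 n X Y "\<lambda>i. (p i, c i)"]
    unfolding 0 word_of_def des_def comaj_def D prod.case
    by (simp add: prod.distrib power_sum flip: prod.inter_filter del: upt_Suc)
qed

text \<open>This is the part of \<open>q powi fmaj\<close> contributed by the colors; the other part
  is \<open>q ^ k\<close> to the power \<open>comaj\<close>, which \<open>wt\<close> yields for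
  \<open>Y = q ^ k\<close>.\<close>

definition color_wt :: "real \<Rightarrow> (nat \<times> nat) list \<Rightarrow> real" where
  "color_wt q w = (\<Prod>l\<leftarrow>w. inverse q ^ snd l)"

lemma color_wt_insert_at:
  "color_wt q (insert_at i a w) = inverse q ^ snd a * color_wt q w"
proof -
  have "color_wt q w = color_wt q (take i w) * color_wt q (drop i w)"
    by (metis append_take_drop_id color_wt_def map_append prod_list.append)
  then show ?thesis by (simp add: color_wt_def insert_at_def)
qed

lemma color_wt_word_of:
  assumes "q \<noteq> 0"
  shows "color_wt q (word_of n (p, c)) = inverse (q powi (\<Sum>i\<in>{1..n}. int (c i)))"
proof -
  have "color_wt q (word_of n (p, c)) = (\<Prod>i\<leftarrow>[Suc 0..<Suc n]. inverse q ^ c i)"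
    by (simp add: color_wt_def word_of_def o_def del: upt_Suc)
  also have "\<dots> = (\<Prod>i\<in>{1..n}. inverse q ^ c i)"
    by (subst prod.distinct_set_conv_list[symmetric])
      (simp_all only: set_upt atLeastLessThanSuc_atLeastAtMost One_nat_def distinct_upt)
  also have "\<dots> = inverse q ^ (\<Sum>i\<in>{1..n}. c i)" by (simp add: power_sum)
  also have "\<dots> = inverse (q powi (\<Sum>i\<in>{1..n}. int (c i)))"
    by (metis of_nat_sum power_int_of_nat power_inverse)
  finally show ?thesis .
qed

lemma poly_euler_mahonian:
  assumes "q > 0"
  shows "poly (euler_mahonian_poly n k q) x =
    (\<Sum>w\<in>words k n. wt x (q ^ k) (0, 0) w * color_wt q w)"
proof -
  have "wt x (q ^ k) (0, 0) (word_of n (p, c)) * color_wt q (word_of n (p, c))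
      = q powi fmaj k n p c * x ^ des n p c" if "(p, c) \<in> colored_perms k n" for p c
  proof -
    have "q powi (int k * int (comaj n p c)) = (q ^ k) ^ comaj n p c"
      by (metis of_nat_mult power_int_of_nat power_mult)
    then show ?thesis
      using assms that
      by (simp add: wt_word_of color_wt_word_of fmaj_def power_int_diff field_simps)
  qed
  then have "(\<Sum>a\<in>colored_perms k n. wt x (q ^ k) (0, 0) (word_of n a) * color_wt q (word_of n a))
      = poly (euler_mahonian_poly n k q) x"
    unfolding euler_mahonian_poly_def poly_sum
    by (intro sum.cong) (auto simp: poly_monom)
  then show ?thesis
    using sum.reindex_bij_betw[OF bij_betw_word_of[of n k],
        of "\<lambda>w. wt x (q ^ k) (0, 0) w * color_wt q w"] by simp
qed

section \<open>The recurrence in n\<close>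

lemma geometric_inverse_sum:
  fixes q :: real
  assumes "q > 0"
  shows "(1 - q) * (q ^ k * (\<Sum>c<k. inverse q ^ c)) = q * (1 - q ^ k)"
proof (induction k)
  case (Suc k)
  have "q ^ Suc k * (\<Sum>c<Suc k. inverse q ^ c) = q * (q ^ k * (\<Sum>c<k. inverse q ^ c)) + q"
    using assms by (simp add: field_simps)
  then have "(1 - q) * (q ^ Suc k * (\<Sum>c<Suc k. inverse q ^ c))
      = q * ((1 - q) * (q ^ k * (\<Sum>c<k. inverse q ^ c))) + (1 - q) * q"
    by (metis distrib_left mult.left_commute)
  also have "\<dots> = q * (1 - q ^ Suc k)"
    unfolding Suc.IH by (simp add: algebra_simps)
  finally show ?case .
qed simp

text \<open>The start letter \<open>(0, 0)\<close> exceeds \<open>(Suc n, c)\<close> exactly when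
  \<open>c > 0\<close>, so \<open>sum_wt_insert_at\<close> gives one formula for color 0 and another
  for all other colors. Summing over the colors leaves a geometric sum in
  \<open>inverse q\<close>.\<close>

lemma sum_insert_letter:
  assumes q: "q > 0" "q \<noteq> 1" and k: "k \<ge> 1" and w: "w \<in> words k n"
  shows "(1 - q) * (\<Sum>c<k. inverse q ^ c *
      (\<Sum>i\<le>n. wt x (q ^ k) (0, 0) (insert_at i (Suc n, c) w))) =
    (1 - x * (q ^ k) ^ Suc n) * wt x (q ^ k) (0, 0) w
      - q * (1 - x) * wt (x * q ^ k) (q ^ k) (0, 0) w"
proof -
  define Q where "Q = q ^ k"
  define I where "I c = (\<Sum>i\<le>n. wt x Q (0, 0) (insert_at i (Suc n, c) w))" for c
  define U where "U = (1 - x * Q ^ Suc n) * wt x Q (0, 0) w"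
  define V where "V = (1 - x) * wt (x * Q) Q (0, 0) w"
  define S where "S = (\<Sum>c<k. inverse q ^ c)"
  have Q1: "Q \<noteq> 1"
    using q k unfolding Q_def by (metis less_le_not_le less_one order_less_imp_le power_eq_1_iff
        abs_of_pos zero_less_one real_norm_def not_one_le_zero)
  have I: "(1 - Q) * I c = (if c = 0 then 1 else Q) * U - Q * V" for c
  proof -
    have "(Suc n, c) \<notin> set w" using w by (force simp: words_def)
    then show ?thesis
      using sum_wt_insert_at[of "(Suc n, c)" w "(0, 0)" Q x] length_words[OF w]
      by (auto simp: I_def U_def V_def letter_gt_def algebra_simps)
  qed
  have S: "(1 - q) * (Q * S) = q * (1 - Q)"
    using geometric_inverse_sum[OF q(1)] by (simp add: S_def Q_def)
  have "(1 - Q) * (\<Sum>c<k. inverse q ^ c * I c) = (\<Sum>c<k. inverse q ^ c * ((1 - Q) * I c))"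
    by (simp add: sum_distrib_left mult_ac)
  \<comment> \<open>Color 0 is treated like the others and its excess \<open>(1 - Q) * U\<close> is
    added separately.\<close>
  also have "\<dots> = (\<Sum>c<k. inverse q ^ c * (Q * U - Q * V) + (if c = 0 then (1 - Q) * U else 0))"
    unfolding I by (intro sum.cong) (auto simp: algebra_simps)
  also have "\<dots> = S * (Q * U - Q * V) + (1 - Q) * U"
    using k by (simp add: sum.distrib S_def flip: sum_distrib_right)
  finally have "(1 - Q) * (\<Sum>c<k. inverse q ^ c * I c) = S * (Q * U - Q * V) + (1 - Q) * U" .
  then have "(1 - Q) * ((1 - q) * (\<Sum>c<k. inverse q ^ c * I c))
      = (1 - q) * (S * (Q * U - Q * V) + (1 - Q) * U)"
    by (metis mult.left_commute)
  \<comment> \<open>Grouped this way, the sum \<open>S\<close> enters only through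
    \<open>(1 - q) * (Q * S)\<close>, so fact \<open>S\<close> makes \<open>1 - Q\<close> a common
    factor that can be cancelled.\<close>
  also have "\<dots> = ((1 - q) * (Q * S)) * (U - V) + (1 - q) * (1 - Q) * U"
    by (simp add: algebra_simps)
  also have "\<dots> = (1 - Q) * (U - q * V)"
    unfolding S by (simp add: algebra_simps)
  finally have "(1 - q) * (\<Sum>c<k. inverse q ^ c * I c) = U - q * V"
    using Q1 by simp
  then show ?thesis
    by (simp add: I_def U_def V_def Q_def mult_ac)
qed

lemma euler_mahonian_recurrence:
  assumes q: "q > 0" "q \<noteq> 1" and k: "k \<ge> 1"
  shows "(1 - q) * poly (euler_mahonian_poly (Suc n) k q) x =
    (1 - x * (q ^ k) ^ Suc n) * poly (euler_mahonian_poly n k q) x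
      - q * (1 - x) * poly (euler_mahonian_poly n k q) (x * q ^ k)"
proof -
  let ?f = "\<lambda>v. wt x (q ^ k) (0, 0) v * color_wt q v"
  let ?ins = "\<lambda>w c i. insert_at i (Suc n, c) w"
  have "poly (euler_mahonian_poly (Suc n) k q) x = (\<Sum>v\<in>words k (Suc n). ?f v)"
    by (rule poly_euler_mahonian[OF q(1)])
  also have "\<dots> = (\<Sum>(w, c, i)\<in>words k n \<times> {..<k} \<times> {..n}. ?f (?ins w c i))"
    unfolding sum.reindex_bij_betw[OF bij_betw_insert_at_words[of n k], of ?f, symmetric]
    by (simp only: case_prod_unfold)
  also have "\<dots> = (\<Sum>w\<in>words k n. \<Sum>c<k. \<Sum>i\<le>n. ?f (?ins w c i))"
    by (simp only: sum.cartesian_product)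
  also have "\<dots> = (\<Sum>w\<in>words k n. color_wt q w * (\<Sum>c<k. inverse q ^ c *
      (\<Sum>i\<le>n. wt x (q ^ k) (0, 0) (?ins w c i))))"
    unfolding color_wt_insert_at sum_distrib_left by (simp only: mult_ac fst_conv snd_conv)
  finally have "(1 - q) * poly (euler_mahonian_poly (Suc n) k q) x =
      (\<Sum>w\<in>words k n. color_wt q w * ((1 - q) * (\<Sum>c<k. inverse q ^ c *
      (\<Sum>i\<le>n. wt x (q ^ k) (0, 0) (insert_at i (Suc n, c) w)))))"
    by (simp only: sum_distrib_left[of "1 - q"] mult.left_commute[of "1 - q"])
  also have "\<dots> = (\<Sum>w\<in>words k n. color_wt q w *
      ((1 - x * (q ^ k) ^ Suc n) * wt x (q ^ k) (0, 0) w
      - q * (1 - x) * wt (x * q ^ k) (q ^ k) (0, 0) w))"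
    using sum_insert_letter[OF q k] by simp
  also have "\<dots> = (1 - x * (q ^ k) ^ Suc n) * poly (euler_mahonian_poly n k q) x
      - q * (1 - x) * poly (euler_mahonian_poly n k q) (x * q ^ k)"
    unfolding poly_euler_mahonian[OF q(1)]
    by (simp add: sum_distrib_left sum_subtractf right_diff_distrib mult_ac)
  finally show ?thesis .
qed

section \<open>Separated roots\<close>

text \<open>A polynomial with constant coefficient 1 is given by its negated reciprocal roots.\<close>

definition lin_prod :: "nat \<Rightarrow> (nat \<Rightarrow> real) \<Rightarrow> real poly" where
  "lin_prod d a = (\<Prod>i<d. [:1, a i:])"

lemma poly_lin_prod: "poly (lin_prod d a) x = (\<Prod>i<d. 1 + a i * x)"
  by (simp add: lin_prod_def poly_prod mult.commute)

lemma degree_lin_prod: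
  assumes "\<And>i. i < d \<Longrightarrow> a i > 0"
  shows "degree (lin_prod d a) = d"
proof -
  have "degree (lin_prod d a) = (\<Sum>i<d. degree [:1, a i:])"
    unfolding lin_prod_def by (rule degree_prod_eq_sum_degree) auto
  also have "\<dots> = (\<Sum>i<d. 1)"
    by (rule sum.cong) (use assms in force)+
  finally show ?thesis by simp
qed

text \<open>At \<open>- s\<close> the first \<open>j\<close> factors \<open>1 - a i * s\<close> are
  negative and the remaining ones are positive.\<close>

lemma sign_lin_prod:
  assumes "j \<le> d" and "\<And>i. i < j \<Longrightarrow> a i * s > 1" and "\<And>i. j \<le> i \<Longrightarrow> i < d \<Longrightarrow> a i * s < 1"
  shows "(- 1) ^ j * poly (lin_prod d a) (- s) > 0"
proof -
  have "{..<d} = {..<j} \<union> {j..<d}" using assms(1) by auto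
  then have "poly (lin_prod d a) (- s) = (\<Prod>i<j. 1 - a i * s) * (\<Prod>i\<in>{j..<d}. 1 - a i * s)"
    by (simp add: poly_lin_prod prod.union_disjoint[symmetric] ivl_disj_int)
  then have "(- 1) ^ j * poly (lin_prod d a) (- s)
      = (\<Prod>i<j. - 1 * (1 - a i * s)) * (\<Prod>i\<in>{j..<d}. 1 - a i * s)"
    by (simp only: prod.distrib prod_constant card_lessThan mult.assoc)
  moreover have "(\<Prod>i<j. - 1 * (1 - a i * s)) > 0"
    by (rule prod_pos) (use assms in auto)
  moreover have "(\<Prod>i\<in>{j..<d}. 1 - a i * s) > 0"
    by (rule prod_pos) (use assms in auto)
  ultimately show ?thesis by simp
qed

lemma factor_lin_prod:
  assumes "\<And>i. i < d \<Longrightarrow> b i \<noteq> 0" and "inj_on b {..<d}"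
    and "\<And>i. i < d \<Longrightarrow> poly h (- 1 / b i) = 0"
  shows "\<exists>g. h = lin_prod d b * g"
  using assms
proof (induction d)
  case 0
  then show ?case by (simp add: lin_prod_def)
next
  case (Suc d)
  then obtain g where g: "h = lin_prod d b * g"
    by (auto simp: lessThan_Suc)
  have neq: "b i \<noteq> b d" if "i < d" for i
    using Suc.prems(2) that by (auto simp: inj_on_def)
  \<comment> \<open>The factors already split off do not vanish at the next root, so that root
    passes to the cofactor \<open>g\<close>.\<close>
  then have "poly (lin_prod d b) (- 1 / b d) \<noteq> 0"
    using Suc.prems(1) by (auto simp: poly_lin_prod field_simps dest: neq)
  then have "poly g (- 1 / b d) = 0"
    using Suc.prems(3)[of d] g by simp
  then obtain g' where "g = [:1 / b d, 1:] * g'"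
    by (auto simp: poly_eq_0_iff_dvd dvd_def)
  moreover have "[:1 / b d, 1:] = smult (1 / b d) [:1, b d:]"
    using Suc.prems(1)[of d] by simp
  ultimately have "h = lin_prod (Suc d) b * smult (1 / b d) g'"
    using g by (simp only: lin_prod_def prod.lessThan_Suc mult.assoc mult_smult_left mult_smult_right)
  then show ?case by blast
qed

text \<open>The roots are \<open>- 1 / a i\<close>, listed by increasing absolute value: all are
  negative, and each is more than \<open>1 / Q\<close> times the one before it.\<close>

definition separated :: "real \<Rightarrow> nat \<Rightarrow> (nat \<Rightarrow> real) \<Rightarrow> bool" where
  "separated Q d a \<longleftrightarrow> (\<forall>i<d. a i > 0) \<and> (\<forall>i. Suc i < d \<longrightarrow> a (Suc i) < Q * a i)"

lemma separated_less:
  assumes "separated Q d a" "0 < Q" "Q < 1" "i < j" "j < d"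
  shows "a j < Q * a i"
proof -
  have "j < d \<longrightarrow> a j < Q * a i" if "Suc i \<le> j"
    using that
  proof (induction j rule: dec_induct)
    case base
    then show ?case using assms(1) by (simp add: separated_def)
  next
    case (step j)
    have "a (Suc j) < Q * a j" "a j > 0" if "Suc j < d"
      using assms(1) that by (auto simp: separated_def)
    moreover have "Q * a j \<le> a j" if "a j > 0"
      using assms(3) that by (simp add: mult_le_cancel_right1)
    ultimately show ?case using step.IH by (meson Suc_lessD order_less_le_trans order_less_trans)
  qed
  then show ?thesis using assms by simp
qed

text \<open>Here \<open>f\<close> and \<open>h\<close> are consecutive polynomials of the family. At
  \<open>- 1 / a j\<close> the first term of the recurrence vanishes, and at
  \<open>- 1 / (Q * a j)\<close> the second, so the sign of \<open>h\<close> is known at both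
  points. The sign changes yield \<open>d\<close> roots; the degree of \<open>h\<close> leaves room
  for at most one more.\<close>

lemma separated_step:
  fixes f h :: "real poly"
  assumes q: "0 < q" "q < 1" and Q: "0 < Q" "Q < 1" and A: "A > 0"
    and sep: "separated Q d a" and f: "f = lin_prod d a"
    and rec: "\<And>x. (1 - q) * poly h x = (1 - x * A) * poly f x - q * (1 - x) * poly f (x * Q)"
    and pos: "\<And>x. x > 0 \<Longrightarrow> poly h x > 0"
  shows "\<exists>d b. separated Q d b \<and> h = lin_prod d b"
proof -
  have apos: "a i > 0" if "i < d" for i using sep that by (simp add: separated_def)
  have degf: "degree f = d" using degree_lin_prod apos f by simp
  have h0: "poly h 0 = 1"
    using rec[of 0] q by (simp add: f poly_lin_prod flip: left_diff_distrib)
  have degh: "degree h \<le> Suc d"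
  proof -
    have eq: "smult (1 - q) h = [:1, - A:] * f - [:q, - q:] * (f \<circ>\<^sub>p [:0, Q:])"
    proof (intro poly_eq_poly_eq_iff[THEN iffD1] ext)
      fix x
      have "poly (smult (1 - q) h) x = (1 - q) * poly h x" by simp
      also have "\<dots> = poly ([:1, - A:] * f - [:q, - q:] * (f \<circ>\<^sub>p [:0, Q:])) x"
        unfolding rec by (simp add: poly_pcompose algebra_simps)
      finally show "poly (smult (1 - q) h) x
        = poly ([:1, - A:] * f - [:q, - q:] * (f \<circ>\<^sub>p [:0, Q:])) x" .
    qed
    have "degree ([:1, - A:] * f) \<le> Suc d"
      using degree_mult_le[of "[:1, - A:]" f] A degf by simp
    moreover have "degree ([:q, - q:] * (f \<circ>\<^sub>p [:0, Q:])) \<le> Suc d"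
      using degree_mult_le[of "[:q, - q:]" "f \<circ>\<^sub>p [:0, Q:]"] q Q
      unfolding degree_pcompose degf by simp
    ultimately have "degree (smult (1 - q) h) \<le> Suc d"
      unfolding eq by (rule degree_diff_le)
    then show ?thesis using q by simp
  qed
  have neg_r: "(- 1) ^ Suc j * poly h (- (1 / a j)) > 0" if j: "j < d" for j
  proof -
    have "(- 1) ^ j * poly (lin_prod d a) (- (Q / a j)) > 0"
    proof (rule sign_lin_prod)
      show "a i * (Q / a j) > 1" if "i < j" for i
        using separated_less[OF sep Q that j] apos[OF j] by (simp add: field_simps)
      show "a i * (Q / a j) < 1" if "j \<le> i" "i < d" for i
      proof (cases "i = j")
        case False
        then have "a i < Q * a j" using separated_less[OF sep Q, of j i] that by simp
        also have "\<dots> < a j / Q"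
          using Q apos[OF j] by (simp add: field_simps) (smt (verit) mult_less_cancel_left2 mult_pos_pos)
        finally show ?thesis using apos[OF j] Q by (simp add: field_simps)
      qed (use apos[OF j] Q in simp)
    qed (use j in simp)
    moreover have "poly f (- (1 / a j)) = 0"
      using j apos[OF j] by (auto simp: f poly_lin_prod)
    then have eq: "(1 - q) * poly h (- (1 / a j)) = - (q * (1 + 1 / a j) * poly f (- (Q / a j)))"
      using rec[of "- (1 / a j)"] by simp
    have "(1 - q) * ((- 1) ^ Suc j * poly h (- (1 / a j)))
        = q * (1 + 1 / a j) * ((- 1) ^ j * poly f (- (Q / a j)))"
      unfolding mult.left_commute[of "1 - q"] eq by (simp add: mult_ac)
    moreover have "q * (1 + 1 / a j) > 0" using q apos[OF j] by (simp add: add_pos_pos)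
    ultimately have "(1 - q) * ((- 1) ^ Suc j * poly h (- (1 / a j))) > 0"
      using f by simp
    then show ?thesis by (rule zero_less_mult_pos) (use q in simp)
  qed
  have neg_l: "(- 1) ^ Suc j * poly h (- (1 / (Q * a j))) > 0" if j: "j < d" for j
  proof -
    have f_sign: "(- 1) ^ Suc j * poly (lin_prod d a) (- (1 / (Q * a j))) > 0"
    proof (rule sign_lin_prod)
      show "a i * (1 / (Q * a j)) > 1" if "i < Suc j" for i
      proof -
        have "Q * a j < a j" using Q apos[OF j] by simp
        also have "a j \<le> a i"
        proof (cases "i = j")
          case False
          then have "a j < Q * a i" "a i > 0"
            using separated_less[OF sep Q, of i j] that j apos by auto
          then show ?thesis using Q by (smt (verit) mult_less_cancel_right2)
        qed simp
        finally show ?thesis using apos[OF j] Q by (simp add: field_simps)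
      qed
      show "a i * (1 / (Q * a j)) < 1" if "Suc j \<le> i" "i < d" for i
        using separated_less[OF sep Q, of j i] that apos[OF j] Q by (simp add: field_simps)
    qed (use j in simp)
    have "poly f (- (1 / a j)) = 0"
      using j apos[OF j] by (auto simp: f poly_lin_prod)
    then have eq: "(1 - q) * poly h (- (1 / (Q * a j)))
        = (1 + A / (Q * a j)) * poly f (- (1 / (Q * a j)))"
      using rec[of "- (1 / (Q * a j))"] Q by simp
    have eq': "(1 - q) * ((- 1) ^ Suc j * poly h (- (1 / (Q * a j))))
        = (1 + A / (Q * a j)) * ((- 1) ^ Suc j * poly f (- (1 / (Q * a j))))"
      unfolding mult.left_commute[of "1 - q"] eq by (rule mult.left_commute)
    have "1 + A / (Q * a j) > 0" using Q A apos[OF j] by (simp add: add_pos_pos)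
    then have "(1 - q) * ((- 1) ^ Suc j * poly h (- (1 / (Q * a j)))) > 0"
      unfolding eq' f using f_sign by (rule mult_pos_pos)
    then show ?thesis by (rule zero_less_mult_pos) (use q in simp)
  qed
  \<comment> \<open>The j-th root is sought between \<open>- (1 / a j)\<close> and
    \<open>- l j\<close>. For \<open>j = 0\<close> the endpoint is 0, where \<open>h\<close> is 1;
    the value at \<open>j = d\<close> serves to locate a possible extra root.\<close>
  define l where "l j = (if j = 0 then 0 else 1 / (Q * a (j - 1)))" for j
  have l_sign: "(- 1) ^ j * poly h (- l j) > 0" if "j \<le> d" for j
    using neg_l[of "j - 1"] that h0 by (cases j) (auto simp: l_def)
  have l_less: "l j < 1 / a j" if "j < d" for j
    using that apos[of j] apos[of "j - 1"] separated_less[OF sep Q, of "j - 1" j] Q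
    by (cases j) (auto simp: l_def field_simps)
  have l_nonneg: "l j \<ge> 0" if "j \<le> d" for j
    using that apos[of "j - 1"] Q by (cases j) (auto simp: l_def zero_le_mult_iff)
  have "\<exists>t. l j < t \<and> t < 1 / a j \<and> poly h (- t) = 0" if j: "j < d" for j
  proof -
    \<comment> \<open>Reflection and the sign make every case a change from positive to negative on
      the positive axis.\<close>
    define P where "P = (- 1) ^ j * h \<circ>\<^sub>p [:0, - 1:]"
    have P: "poly P x = (- 1) ^ j * poly h (- x)" for x
      by (simp add: P_def poly_pcompose)
    have "poly P (l j) > 0" "poly P (1 / a j) < 0"
      using l_sign[of j] neg_r[OF j] j unfolding P by auto
    then obtain t where "l j < t" "t < 1 / a j" "poly P t = 0"
      using poly_IVT_neg[OF l_less[OF j]] by blast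
    then show ?thesis using P by auto
  qed
  then obtain t where t: "\<And>j. j < d \<Longrightarrow> l j < t j \<and> t j < 1 / a j \<and> poly h (- t j) = 0"
    by metis
  have tpos: "t j > 0" if "j < d" for j
    using t[OF that] l_nonneg[of j] that by simp
  define b where "b j = 1 / t j" for j
  have bpos: "b j > 0" if "j < d" for j using tpos[OF that] by (simp add: b_def)
  have ab: "a j < b j" if "j < d" for j
    using t[OF that] tpos[OF that] apos[OF that] by (simp add: b_def field_simps)
  \<comment> \<open>The root with index \<open>Suc j\<close> lies beyond
    \<open>1 / (Q * a j)\<close> in absolute value, while root \<open>j\<close> stays below
    \<open>1 / a j\<close>. Hence \<open>b (Suc j) < Q * a j < Q * b j\<close>, which restores the
    separation.\<close>
  have bQ: "b (Suc j) < Q * a j" if "Suc j < d" for j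
    using t[OF that] tpos[OF that] apos[of j] that Q by (simp add: b_def l_def field_simps)
  have sepb: "separated Q d b"
    using bQ ab bpos Q unfolding separated_def
    by (metis Suc_lessD mult_less_cancel_left_pos order_less_trans)
  have "inj_on b {..<d}"
  proof (rule linorder_inj_onI)
    fix i j assume "i < j" "j \<in> {..<d}"
    then have "b j < Q * b i" "b i > 0" using separated_less[OF sepb Q] bpos by auto
    moreover have "Q * b i < b i" if "b i > 0" using Q that by simp
    ultimately show "b i \<noteq> b j" by linarith
  qed auto
  moreover have "poly h (- 1 / b j) = 0" if "j < d" for j
    using t[OF that] by (simp add: b_def)
  moreover have "b j \<noteq> 0" if "j < d" for j
    using bpos[OF that] by simp
  ultimately obtain g where g: "h = lin_prod d b * g"
    using factor_lin_prod[of d b h] by blast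
  have h_nz: "h \<noteq> 0" using h0 by auto
  then have "degree h = d + degree g"
    using g degree_mult_eq[of "lin_prod d b" g] degree_lin_prod[of d b, OF bpos] by auto
  then have "degree g \<le> 1" using degh by simp
  obtain c0 g' where g': "g = pCons c0 g'" by (cases g)
  with \<open>degree g \<le> 1\<close> have "degree g' = 0" by (auto simp: degree_pCons_eq_if split: if_splits)
  then obtain c where "g' = [:c:]" by (rule degree_eq_zeroE)
  then have gc: "g = [:c0, c:]" using g' by simp
  have "c0 = 1" using h0 g by (simp add: gc poly_lin_prod)
  then have gc: "g = [:1, c:]" using gc by simp
  \<comment> \<open>A negative \<open>c\<close> would give \<open>h\<close> a positive root, against
    \<open>pos\<close>.\<close>
  have c_nonneg: "c \<ge> 0"
  proof (rule ccontr)
    assume "\<not> c \<ge> 0"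
    then have "poly g (- 1 / c) = 0" "- 1 / c > 0" by (auto simp: gc field_simps)
    then show False using pos[of "- 1 / c"] g by simp
  qed
  show ?thesis
  proof (cases "c = 0")
    case True
    then have "h = lin_prod d b" using g gc by simp
    then show ?thesis using sepb by blast
  next
    case False
    \<comment> \<open>At \<open>- l d\<close> the factors found so far already produce the sign of
      \<open>h\<close>, so \<open>g\<close> is positive there. This places the extra root
      \<open>- 1 / c\<close> beyond \<open>- l d\<close>, that is, \<open>c < Q * a i\<close>. For
      \<open>d = 0\<close> there is nothing to separate from.\<close>
    have last: "c < Q * b i" if d: "d = Suc i" for i
    proof -
      have "(- 1) ^ d * poly (lin_prod d b) (- l d) > 0"
      proof (rule sign_lin_prod)
        fix j assume j: "j < d"
        have "b i \<le> b j"
          using separated_less[OF sepb Q, of j i] j d bpos[OF j] Q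
          by (cases "j = i") (auto, smt (verit) mult_less_cancel_right2)
        moreover have "b i > a i" "a i > 0" using ab[of i] apos[of i] d by auto
        moreover have "Q * a i < a i" using Q \<open>a i > 0\<close> by simp
        ultimately have "Q * a i < b j" by linarith
        moreover have "0 < Q * a i" using Q \<open>a i > 0\<close> by simp
        ultimately show "b j * l d > 1"
          by (simp add: l_def d field_simps)
      qed auto
      moreover have "((- 1) ^ d * poly (lin_prod d b) (- l d)) * poly g (- l d) > 0"
        using l_sign[of d] g by (simp add: mult.assoc)
      ultimately have "poly g (- l d) > 0"
        by (metis zero_less_mult_pos)
      then have "c < Q * a i"
        using apos[of i] Q d by (simp add: gc l_def field_simps)
      also have "\<dots> < Q * b i" using ab[of i] d Q by simp
      finally show ?thesis .
    qed
    define b' where "b' = b(d := c)"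
    have "lin_prod d b' = lin_prod d b"
      unfolding lin_prod_def by (intro prod.cong) (auto simp: b'_def)
    then have "lin_prod (Suc d) b' = h"
      using g gc by (simp add: lin_prod_def b'_def)
    moreover have "separated Q (Suc d) b'"
      using sepb last c_nonneg False
      by (auto simp: separated_def b'_def less_Suc_eq)
    ultimately show ?thesis by blast
  qed
qed

section \<open>A lower bound for the modulus away from the real axis\<close>

lemma map_poly_of_real_mult:
  "map_poly complex_of_real (p * q) = map_poly complex_of_real p * map_poly complex_of_real q"
  by (intro poly_eqI) (simp add: coeff_map_poly coeff_mult)

text \<open>The modulus of each factor \<open>1 + a i * z\<close> is at least that of its imaginary
  part, \<open>a i * \<bar>Im z\<bar>\<close>, and the product of the \<open>a i\<close> is the
  leading coefficient.\<close>

lemma norm_lin_prod_ge: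
  assumes "\<And>i. i < d \<Longrightarrow> a i > 0"
  shows "norm (poly (map_poly complex_of_real (lin_prod d a)) z)
    \<ge> lead_coeff (lin_prod d a) * \<bar>Im z\<bar> ^ degree (lin_prod d a)"
proof -
  have eq: "poly (map_poly complex_of_real (lin_prod d a)) z
      = (\<Prod>i<d. 1 + complex_of_real (a i) * z)"
    unfolding lin_prod_def
  proof (induction d)
    case (Suc d)
    have "poly (map_poly complex_of_real [:1, a d:]) z = 1 + complex_of_real (a d) * z"
      by (simp add: map_poly_pCons mult.commute)
    then show ?case
      using Suc.IH by (simp only: prod.lessThan_Suc map_poly_of_real_mult poly_mult)
  qed simp
  have deg: "degree (lin_prod d a) = d"
    using assms by (rule degree_lin_prod)
  have lc: "lead_coeff (lin_prod d a) = (\<Prod>i<d. a i)"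
    unfolding lin_prod_def lead_coeff_prod using assms
    by (intro prod.cong) (auto, metis assms less_irrefl)
  have "(\<Prod>i<d. a i) * \<bar>Im z\<bar> ^ d = (\<Prod>i<d. a i * \<bar>Im z\<bar>)"
    by (simp add: prod.distrib)
  also have "\<dots> \<le> (\<Prod>i<d. norm (1 + complex_of_real (a i) * z))"
  proof (rule prod_mono)
    fix i assume "i \<in> {..<d}"
    then have "a i > 0" using assms by simp
    then show "0 \<le> a i * \<bar>Im z\<bar> \<and> a i * \<bar>Im z\<bar> \<le> norm (1 + complex_of_real (a i) * z)"
      using abs_Im_le_cmod[of "1 + complex_of_real (a i) * z"] by (simp add: abs_mult)
  qed
  finally show ?thesis
    unfolding eq lc unfolding deg by (simp add: prod_norm)
qed

section \<open>Euler--Mahonian polynomials\<close>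

lemma finite_colored_perms: "finite (colored_perms k n)"
proof -
  have "finite (words k n)"
  proof (induction n)
    case (Suc n)
    then show ?case using bij_betw_finite[OF bij_betw_insert_at_words[of n k]] by simp
  qed simp
  then show ?thesis using bij_betw_finite[OF bij_betw_word_of] by blast
qed

section \<open>Coefficients, degree and positivity\<close>

lemma coeff_euler_mahonian:
  "coeff (euler_mahonian_poly n k q) i =
    (\<Sum>(p, c)\<in>colored_perms k n. if des n p c = i then q powi fmaj k n p c else 0)"
  unfolding euler_mahonian_poly_def coeff_sum
  by (intro sum.cong) auto

lemma coeff_euler_mahonian_nonneg:
  "q > 0 \<Longrightarrow> coeff (euler_mahonian_poly n k q) i \<ge> 0"
  unfolding coeff_euler_mahonian by (intro sum_nonneg) auto

text \<open>Positive terms cannot cancel. The right-hand side is free of \<open>q\<close>, which is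
  why the degree does not depend on \<open>q\<close>.\<close>

lemma coeff_euler_mahonian_eq_0_iff:
  assumes "q > 0"
  shows "coeff (euler_mahonian_poly n k q) i = 0 \<longleftrightarrow>
    (\<forall>(p, c)\<in>colored_perms k n. des n p c \<noteq> i)"
proof -
  have "coeff (euler_mahonian_poly n k q) i = 0 \<longleftrightarrow> (\<forall>a\<in>colored_perms k n.
      (case a of (p, c) \<Rightarrow> if des n p c = i then q powi fmaj k n p c else 0) = 0)"
    unfolding coeff_euler_mahonian
    by (rule sum_nonneg_eq_0_iff) (use assms finite_colored_perms in auto)
  then show ?thesis using assms by (simp add: case_prod_unfold)
qed

lemma degree_euler_mahonian:
  assumes "q > 0"
  shows "degree (euler_mahonian_poly n k q) = degree (euler_mahonian_poly n k 1)"
  using assms by (simp add: degree_def coeff_euler_mahonian_eq_0_iff)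

lemma lead_coeff_euler_mahonian_pos:
  assumes "k \<ge> 1" "q > 0"
  shows "lead_coeff (euler_mahonian_poly n k q) > 0"
proof -
  \<comment> \<open>One colored permutation suffices to make the polynomial nonzero; color 0 is
    available because \<open>k\<close> is positive.\<close>
  have "(id, \<lambda>_. 0) \<in> colored_perms k n"
    using assms(1) by (simp add: colored_perms_def permutes_id)
  then have "coeff (euler_mahonian_poly n k q) (des n id (\<lambda>_. 0)) \<noteq> 0"
    using coeff_euler_mahonian_eq_0_iff[OF assms(2)] by blast
  then have "lead_coeff (euler_mahonian_poly n k q) \<noteq> 0" by auto
  then show ?thesis
    using coeff_euler_mahonian_nonneg[OF assms(2)] by (metis order_le_less)
qed

lemma poly_euler_mahonian_pos:
  assumes "k \<ge> 1" "q > 0" "x > 0"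
  shows "poly (euler_mahonian_poly n k q) x > 0"
  unfolding poly_altdef
proof (rule sum_pos2)
  let ?G = "euler_mahonian_poly n k q"
  show "degree ?G \<in> {..degree ?G}" by simp
  show "0 < coeff ?G (degree ?G) * x ^ degree ?G"
    using lead_coeff_euler_mahonian_pos assms by simp
  show "0 \<le> coeff ?G i * x ^ i" for i
    using coeff_euler_mahonian_nonneg assms by simp
qed simp

section \<open>Factorization for q different from 1, and the limit at 1\<close>

lemma euler_mahonian_poly_0:
  assumes "q > 0"
  shows "euler_mahonian_poly 0 k q = 1"
  by (intro poly_eq_poly_eq_iff[THEN iffD1] ext)
    (simp add: poly_euler_mahonian[OF assms] color_wt_def)

lemma euler_mahonian_separated:
  assumes "0 < q" "q < 1" "k \<ge> 1"
  shows "\<exists>d a. separated (q ^ k) d a \<and> euler_mahonian_poly n k q = lin_prod d a"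
proof (induction n)
  case 0
  show ?case
    using assms(1)
    by (intro exI[of _ 0]) (simp add: euler_mahonian_poly_0 separated_def lin_prod_def)
next
  case (Suc n)
  then obtain d a where a: "separated (q ^ k) d a" "euler_mahonian_poly n k q = lin_prod d a"
    by blast
  have Q: "0 < q ^ k" "q ^ k < 1" "0 < (q ^ k) ^ Suc n"
    using assms by (simp_all add: power_less_one_iff)
  show ?case
  proof (rule separated_step[OF assms(1,2) Q a])
    show "(1 - q) * poly (euler_mahonian_poly (Suc n) k q) x =
        (1 - x * (q ^ k) ^ Suc n) * poly (euler_mahonian_poly n k q) x
          - q * (1 - x) * poly (euler_mahonian_poly n k q) (x * q ^ k)" for x
      using assms by (intro euler_mahonian_recurrence) auto
    show "poly (euler_mahonian_poly (Suc n) k q) x > 0" if "x > 0" for x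
      using assms that by (intro poly_euler_mahonian_pos)
  qed
qed

text \<open>By induction along the recurrence: replacing \<open>q\<close> by
  \<open>inverse q\<close> and rescaling the argument interchanges its two terms, up to the factor
  \<open>- q\<close> that also turns \<open>1 - inverse q\<close> into \<open>1 - q\<close>.\<close>

lemma euler_mahonian_inverse:
  assumes "q > 0" "q \<noteq> 1" "k \<ge> 1"
  shows "poly (euler_mahonian_poly n k (inverse q)) x =
    poly (euler_mahonian_poly n k q) (x / (q ^ k) ^ n)"
proof (induction n arbitrary: x)
  case 0
  then show ?case using assms by (simp add: euler_mahonian_poly_0)
next
  case (Suc n)
  define Q where "Q = q ^ k"
  define y where "y = x / Q ^ Suc n"
  define F where "F = poly (euler_mahonian_poly n k q)"
  have Q: "Q > 0" using assms by (simp add: Q_def)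
  have x: "x = y * Q ^ Suc n" using Q by (simp add: y_def)
  have IH: "poly (euler_mahonian_poly n k (inverse q)) t = F (t / Q ^ n)" for t
    using Suc.IH by (simp add: Q_def F_def)
  have "(1 - inverse q) * poly (euler_mahonian_poly (Suc n) k (inverse q)) x =
      (1 - x * inverse Q ^ Suc n) * F (x / Q ^ n) - inverse q * (1 - x) * F (x * inverse Q / Q ^ n)"
    using euler_mahonian_recurrence[of "inverse q" k n x] assms
    by (simp add: IH Q_def power_inverse)
  also have "x / Q ^ n = y * Q" using Q by (simp add: x)
  also have "x * inverse Q / Q ^ n = y" using Q by (simp add: x)
  also have "x * inverse Q ^ Suc n = y"
    using Q by (simp add: y_def power_inverse divide_inverse)
  finally have eq: "(1 - inverse q) * poly (euler_mahonian_poly (Suc n) k (inverse q)) x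
      = (1 - y) * F (y * Q) - inverse q * (1 - x) * F y" .
  have "q * (1 - inverse q) = q - 1" using assms(1) by (simp add: right_diff_distrib)
  then have "(q - 1) * poly (euler_mahonian_poly (Suc n) k (inverse q)) x
      = q * ((1 - y) * F (y * Q) - inverse q * (1 - x) * F y)"
    unfolding eq[symmetric] mult.assoc[symmetric] by simp
  then have "(q - 1) * poly (euler_mahonian_poly (Suc n) k (inverse q)) x
      = q * (1 - y) * F (y * Q) - (1 - x) * F y"
    using assms(1) by (simp add: right_diff_distrib[of q] mult.assoc[symmetric])
  moreover have "(1 - q) * poly (euler_mahonian_poly (Suc n) k q) y
      = (1 - x) * F y - q * (1 - y) * F (y * Q)"
    using euler_mahonian_recurrence[OF assms, of n y] by (simp add: F_def Q_def x)
  ultimately have "(1 - q) * poly (euler_mahonian_poly (Suc n) k (inverse q)) x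
      = (1 - q) * poly (euler_mahonian_poly (Suc n) k q) y"
    by (simp add: left_diff_distrib)
  then show ?case using assms(2) by (simp add: y_def Q_def)
qed

lemma euler_mahonian_lin_prod:
  assumes "q > 0" "q \<noteq> 1" "k \<ge> 1"
  shows "\<exists>d a. (\<forall>i<d. a i > 0) \<and> euler_mahonian_poly n k q = lin_prod d a"
proof (cases "q < 1")
  case True
  then show ?thesis using euler_mahonian_separated assms unfolding separated_def by blast
next
  case False
  define p where "p = inverse q"
  have p: "0 < p" "p < 1" "p \<noteq> 1" "q = inverse p"
    using False assms by (simp_all add: p_def inverse_less_1_iff)
  obtain d a where a: "separated (p ^ k) d a" "euler_mahonian_poly n k p = lin_prod d a"
    using euler_mahonian_separated p assms(3) by blast
  \<comment> \<open>Rescaling the argument by a positive number divides every \<open>a i\<close> by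
    it and so keeps them positive.\<close>
  have "euler_mahonian_poly n k q = lin_prod d (\<lambda>i. a i / (p ^ k) ^ n)"
    unfolding p(4)
    by (intro poly_eq_poly_eq_iff[THEN iffD1] ext)
      (simp add: euler_mahonian_inverse[OF p(1,3) assms(3)] a(2) poly_lin_prod)
  moreover have "\<forall>i<d. a i / (p ^ k) ^ n > 0"
    using a(1) p(1) by (simp add: separated_def)
  ultimately show ?thesis by (intro exI conjI)
qed

text \<open>Unlike real-rootedness itself, this inequality visibly passes to the limit \<open>q \<rightarrow> 1\<close>.\<close>

lemma norm_euler_mahonian_ge:
  assumes "q > 0" "k \<ge> 1"
  shows "norm (poly (map_poly complex_of_real (euler_mahonian_poly n k q)) z)
    \<ge> lead_coeff (euler_mahonian_poly n k q) * \<bar>Im z\<bar> ^ degree (euler_mahonian_poly n k q)"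
proof (cases "q = 1")
  case False
  then show ?thesis using euler_mahonian_lin_prod assms norm_lin_prod_ge by metis
next
  case True
  let ?G = "euler_mahonian_poly n k"
  \<comment> \<open>A common degree for all positive \<open>r\<close> allows one fixed summation
    range, so the limit can be taken coefficientwise.\<close>
  define D where "D = degree (?G 1)"
  have deg: "degree (?G r) = D" if "r > 0" for r
    unfolding D_def using that by (rule degree_euler_mahonian)
  have ev: "eventually (\<lambda>r. r \<in> {0<..<1}) (at_left (1::real))"
    by (rule eventually_at_left_real) simp
  have coeff_lim: "((\<lambda>r. coeff (?G r) i) \<longlongrightarrow> coeff (?G 1) i) (at_left 1)" for i
  proof -
    have "((\<lambda>r. if b then r powi m else 0) \<longlongrightarrow> (if b then 1 powi m else 0)) (at_left (1::real))"
      for b m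
      using tendsto_power_int[OF tendsto_ident_at, of "1::real" m "{..<1}"] by (cases b) simp_all
    then show ?thesis
      unfolding coeff_euler_mahonian case_prod_unfold by (intro tendsto_sum)
  qed
  have altdef: "poly (map_poly complex_of_real (?G r)) z
      = (\<Sum>i\<le>D. complex_of_real (coeff (?G r) i) * z ^ i)" if "r > 0" for r
    using deg[OF that] by (simp add: poly_altdef degree_map_poly coeff_map_poly)
  have "((\<lambda>r. \<Sum>i\<le>D. complex_of_real (coeff (?G r) i) * z ^ i)
      \<longlongrightarrow> (\<Sum>i\<le>D. complex_of_real (coeff (?G 1) i) * z ^ i)) (at_left 1)"
    by (intro tendsto_intros coeff_lim)
  then have lim: "((\<lambda>r. norm (\<Sum>i\<le>D. complex_of_real (coeff (?G r) i) * z ^ i))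
      \<longlongrightarrow> norm (poly (map_poly complex_of_real (?G 1)) z)) (at_left 1)"
    using altdef[of 1] by (intro tendsto_norm) simp
  have "coeff (?G 1) D * \<bar>Im z\<bar> ^ D \<le> norm (poly (map_poly complex_of_real (?G 1)) z)"
  proof (rule tendsto_le[OF _ lim tendsto_mult[OF coeff_lim tendsto_const]])
    show "eventually (\<lambda>r. coeff (?G r) D * \<bar>Im z\<bar> ^ D
        \<le> norm (\<Sum>i\<le>D. complex_of_real (coeff (?G r) i) * z ^ i)) (at_left 1)"
      using ev
    proof eventually_elim
      case (elim r)
      then have r: "r > 0" "r \<noteq> 1" by auto
      obtain d a where "\<forall>i<d. a i > 0" "?G r = lin_prod d a"
        using euler_mahonian_lin_prod[OF r assms(2)] by blast
      then have "lead_coeff (?G r) * \<bar>Im z\<bar> ^ degree (?G r)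
          \<le> norm (poly (map_poly complex_of_real (?G r)) z)"
        using norm_lin_prod_ge[of d a z] by simp
      then show ?case using deg[OF r(1)] altdef[OF r(1)] by simp
    qed
  qed simp
  then show ?thesis using True by (simp add: D_def)
qed

theorem theorem5p9:
  fixes n k :: nat and q :: real
  assumes "n \<ge> 1" and "k \<ge> 1" and "q > 0"
  shows "real_rooted (euler_mahonian_poly n k q)"
  unfolding real_rooted_def
proof (intro allI impI)
  fix z
  assume "poly (map_poly complex_of_real (euler_mahonian_poly n k q)) z = 0"
  then have "lead_coeff (euler_mahonian_poly n k q)
      * \<bar>Im z\<bar> ^ degree (euler_mahonian_poly n k q) \<le> 0"
    using norm_euler_mahonian_ge[OF assms(3,2), of n z] by simp
  then have "\<bar>Im z\<bar> ^ degree (euler_mahonian_poly n k q) \<le> 0"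
    using lead_coeff_euler_mahonian_pos[OF assms(2,3), of n] by (simp add: mult_le_0_iff)
  \<comment> \<open>A nonzero imaginary part would make the power positive. In degree 0 the power is
    1, so the inequality itself is contradictory and there are no roots.\<close>
  then have "Im z = 0"
    by (metis abs_le_zero_iff abs_ge_zero not_le zero_less_abs_iff zero_less_power)
  then show "z \<in> \<real>" by (simp add: complex_is_Real_iff)
qed

end
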